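(* Let $d\geq 2$ and let $f:\mathbb{Z}^{d}\to\mathbb{R}$ be a function in $\ell^{1}(\mathbb{Z}^{d})$. Then $$\operatorname{Var} M_{1}f\leq C(d)\,\|f\|_{\ell^{1}(\mathbb{Z}^{d})},\qquad C(d):=2d\left(1+\sum_{k\geq 1}\frac{N_{1,d-1}(k)-N_{1,d-1}(k-1)}{N_{1,d}(k)}\right),$$ and this constant $C(d)$ is the best possible (i.e. it is the smallest constant $C$ such that $\operatorname{Var} M_1f\le C\|f\|_{\ell^1(\mathbb{Z}^d)}$ for all $f\in\ell^1(\mathbb{Z}^d)$). Moreover, equality $\operatorname{Var} M_1f=C(d)\|f\|_{\ell^1(\mathbb{Z}^d)}$ is attained if and only if $f$ is a delta function.
   Context: For $f:\mathbb{Z}^d\to\mathbb{R}$: $\|f\|_{\ell^1(\mathbb{Z}^d)}=\sum_{\vec n\in\mathbb{Z}^d}|f(\vec n)|$, and the total variation is $\operatorname{Var} f=\sum_{i=1}^d\sum_{\vec n\in\mathbb{Z}^d}|f(\vec n+\vec e_i)-f(\vec n)|$, where $\vec e_i$ is the $i$-th canonical basis vector. For $\vec x=(x_1,\dots,x_d)$ write $\|\vec x\|_1=|x_1|+\dots+|x_d|$. For integers $d\ge 1$ and $k\ge 0$, $N_{1,d}(k)=\big|\{\vec x\in\mathbb{Z}^d;\ \|\vec x\|_1\le k\}\big|$. The discrete centered maximal operator associated to $\ell^1$-balls is $$M_1f(\vec n)=\sup_{r\ge 0}\ \frac{1}{N(r)}\sum_{\vec m\in\mathbb{Z}^d,\ \|\vec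 m\|_1\le r}|f(\vec n+\vec m)|,\qquad \vec n\in\mathbb{Z}^d,$$ where $r$ ranges over nonnegative reals and $N(r)$ is the number of $\vec m\in\mathbb{Z}^d$ with $\|\vec m\|_1\le r$. A function $f:\mathbb{Z}^d\to\mathbb{R}$ is a delta function if there exist $\vec p\in\mathbb{Z}^d$ and $k\in\mathbb{R}$ such that $f(\vec p)=k$ and $f(\vec n)=0$ for all $\vec n\in\mathbb{Z}^d\setminus\{\vec p\}$ (the value $k=0$ is allowed). *)

theory Defs
  imports "HOL-Analysis.Analysis"
begin

text \<open>
  The lattice \<open>\<int>\<^sup>d\<close> is the type \<open>int ^ 'd\<close>, with \<open>d = CARD('d)\<close>.
\<close>

definition l1_abs :: "int ^ 'd \<Rightarrow> int" where
  "l1_abs x = (\<Sum>i\<in>UNIV. \<bar>x $ i\<bar>)"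

definition l1_ball :: "real \<Rightarrow> (int ^ 'd) set" where
  "l1_ball r = {m. real_of_int (l1_abs m) \<le> r}"

text \<open>
  The constant \<open>C(d)\<close> relates the dimensions \<open>d\<close> and \<open>d - 1\<close>, so here the
  dimension is a number and integer vectors are lists of that length;
  \<open>card_l1_ball\<close> below identifies the two ways of counting.
\<close>

definition N1 :: "nat \<Rightarrow> nat \<Rightarrow> nat" where
  "N1 d k = card {xs :: int list. length xs = d \<and> (\<Sum>x\<leftarrow>xs. \<bar>x\<bar>) \<le> int k}"

lemma card_l1_ball: "card (l1_ball (real k) :: (int ^ 'd) set) = N1 CARD('d) k"
proof -
  obtain js :: "'d list" where js: "set js = UNIV" "distinct js"
    using finite_distinct_list[OF finite] by blast
  have len: "length js = CARD('d)"
    using js by (metis distinct_card)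
  have sum: "(\<Sum>x\<leftarrow>map (($) v) js. \<bar>x\<bar>) = l1_abs v" for v :: "int ^ 'd"
    using js by (simp add: l1_abs_def sum_list_distinct_conv_sum_set o_def)
  have "bij_betw (\<lambda>v :: int ^ 'd. map (($) v) js) (l1_ball (real k))
          {xs. length xs = CARD('d) \<and> (\<Sum>x\<leftarrow>xs. \<bar>x\<bar>) \<le> int k}"
    unfolding bij_betw_def
  proof
    show "inj_on (\<lambda>v :: int ^ 'd. map (($) v) js) (l1_ball (real k))"
      using js by (auto simp: inj_on_def vec_eq_iff)
    show "(\<lambda>v :: int ^ 'd. map (($) v) js) ` l1_ball (real k) =
            {xs. length xs = CARD('d) \<and> (\<Sum>x\<leftarrow>xs. \<bar>x\<bar>) \<le> int k}" (is "_ = ?R")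
    proof (intro equalityI subsetI)
      fix xs assume "xs \<in> (\<lambda>v :: int ^ 'd. map (($) v) js) ` l1_ball (real k)"
      then show "xs \<in> ?R"
        using sum len by (auto simp: l1_ball_def simp del: map_map)
    next
      fix xs assume xs: "xs \<in> ?R"
      define v :: "int ^ 'd" where "v = (\<chi> i. the (map_of (zip js xs) i))"
      have "map (($) v) js = xs"
        using xs js len by (auto simp: v_def intro!: nth_equalityI simp: map_of_zip_nth)
      then show "xs \<in> (\<lambda>v :: int ^ 'd. map (($) v) js) ` l1_ball (real k)"
        using xs sum[of v] by (intro image_eqI[of _ _ v]) (auto simp: l1_ball_def)
    qed
  qed
  then show ?thesis
    unfolding N1_def by (rule bij_betw_same_card)
qed

definition C_term :: "nat \<Rightarrow> nat \<Rightarrow> real" where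
  "C_term d k = (real (N1 (d - 1) k) - real (N1 (d - 1) (k - 1))) / real (N1 d k)"

definition C_const :: "nat \<Rightarrow> real" where
  "C_const d = 2 * real d * (1 + (\<Sum>\<^sub>\<infinity>k\<in>{1..}. C_term d k))"

definition in_l1 :: "(int ^ 'd \<Rightarrow> real) \<Rightarrow> bool" where
  "in_l1 f \<longleftrightarrow> (\<lambda>n. \<bar>f n\<bar>) summable_on UNIV"

definition l1_norm :: "(int ^ 'd \<Rightarrow> real) \<Rightarrow> real" where
  "l1_norm f = (\<Sum>\<^sub>\<infinity>n. \<bar>f n\<bar>)"

text \<open>The variation is a sum in \<open>[0, \<infinity>]\<close>, so that a divergent sum counts as \<open>\<infinity>\<close>.\<close>

definition Var :: "(int ^ 'd \<Rightarrow> real) \<Rightarrow> ennreal" where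
  "Var f = (\<Sum>i\<in>UNIV. \<Sum>\<^sub>\<infinity>n. ennreal \<bar>f (n + axis i 1) - f n\<bar>)"

text \<open>
  A real supremum: for \<open>f\<close> in \<open>\<ell>\<^sup>1\<close> the averages are bounded by the norm of \<open>f\<close>.
\<close>

definition M1 :: "(int ^ 'd \<Rightarrow> real) \<Rightarrow> int ^ 'd \<Rightarrow> real" where
  "M1 f n = (SUP r\<in>{0::real..}.
     (\<Sum>m\<in>l1_ball r. \<bar>f (n + m)\<bar>) / real (card (l1_ball r :: (int ^ 'd) set)))"

definition is_delta :: "(int ^ 'd \<Rightarrow> real) \<Rightarrow> bool" where
  "is_delta f \<longleftrightarrow> (\<exists>p k. f p = k \<and> (\<forall>n. n \<noteq> p \<longrightarrow> f n = 0))"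

end

theory Submission
  imports Defs
begin

text \<open>
  Let \<open>N = N1 d\<close>. For neighbours \<open>u\<close> and \<open>v = u \<plusminus> e\<^sub>i\<close>, the ball of radius \<open>k\<close> at \<open>u\<close> lies in the ball of radius \<open>k + 1\<close> at \<open>v\<close>,
  so \<open>M1 f u - M1 f v\<close> is at most the mass of the former ball times \<open>1 / N(k) - 1 / N(k + 1)\<close>. As \<open>N\<close> is
  log-concave, \<open>1 / N\<close> is convex, and this is bounded by a sum over \<open>m\<close> of \<open>\<bar>f m\<bar>\<close> times
  the jump along the edge of \<open>n \<mapsto> 1 / N(\<parallel>n - m\<parallel>\<^sub>1)\<close>, the maximal function of the unit mass at \<open>m\<close>. Summing
  over edges, \<open>Var (M1 f)\<close> is at most \<open>\<parallel>f\<parallel>\<^sub>1\<close> times the variation for the unit mass, which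
  telescopes on every line to twice the maximum there. If \<open>f\<close> charges two points \<open>m\<^sub>0\<close> and \<open>m\<^sub>1\<close>, the bound is strict on
  an edge at \<open>m\<^sub>0\<close> that avoids \<open>m\<^sub>1\<close>.
\<close>

section \<open>Lattice points in \<open>\<ell>\<^sup>1\<close>-balls\<close>

definition list_ball :: "nat \<Rightarrow> nat \<Rightarrow> int list set" where
  "list_ball d k = {xs. length xs = d \<and> (\<Sum>x\<leftarrow>xs. \<bar>x\<bar>) \<le> int k}"

lemma N1_eq_card_list_ball: "N1 d k = card (list_ball d k)"
  by (simp add: N1_def list_ball_def)

lemma finite_list_ball [simp]: "finite (list_ball d k)"
proof (rule finite_subset)
  show "list_ball d k \<subseteq> {xs. set xs \<subseteq> {- int k..int k} \<and> length xs = d}"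
  proof
    fix xs assume xs: "xs \<in> list_ball d k"
    have "\<bar>x\<bar> \<le> int k" if "x \<in> set xs" for x
    proof -
      have "\<bar>x\<bar> \<le> (\<Sum>x\<leftarrow>xs. \<bar>x\<bar>)"
        using that by (intro member_le_sum_list) auto
      with xs show ?thesis by (simp add: list_ball_def)
    qed
    then show "xs \<in> {xs. set xs \<subseteq> {- int k..int k} \<and> length xs = d}"
      using xs by (auto simp: list_ball_def abs_le_iff)
         (metis minus_le_iff)+
  qed
  show "finite {xs. set xs \<subseteq> {- int k..int k} \<and> length xs = d}"
    by (rule finite_lists_length_eq) simp
qed

lemma N1_0_left [simp]: "N1 0 k = 1"
proof -
  have "list_ball 0 k = {[]}" by (auto simp: list_ball_def)
  then show ?thesis by (simp add: N1_eq_card_list_ball)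
qed

lemma N1_0_right [simp]: "N1 d 0 = 1"
proof -
  have zero: "(\<Sum>x\<leftarrow>xs. \<bar>x\<bar>) \<le> 0 \<Longrightarrow> set xs \<subseteq> {0}" for xs :: "int list"
  proof (induction xs)
    case (Cons a xs)
    moreover have "0 \<le> (\<Sum>x\<leftarrow>xs. \<bar>x\<bar>)" by (rule sum_list_nonneg) auto
    ultimately show ?case by auto
  qed simp
  have "list_ball d 0 = {replicate d 0}"
  proof (intro equalityI subsetI)
    fix xs assume "xs \<in> list_ball d 0"
    then have "length xs = d" "set xs \<subseteq> {0}"
      using zero[of xs] by (auto simp: list_ball_def)
    then show "xs \<in> {replicate d 0}"
      by (auto intro!: replicate_eqI)
  qed (auto simp: list_ball_def sum_list_replicate)
  then show ?thesis by (simp add: N1_eq_card_list_ball)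
qed

text \<open>
  The generating function of \<open>N1 d\<close> is \<open>(1 + x)\<^sup>d / (1 - x)\<^sup>d\<^sup>+\<^sup>1\<close>; combinatorially, a nonzero first
  coordinate is moved one step towards \<open>0\<close>, where \<open>0\<close> itself is reached from both sides.
\<close>

lemma N1_Suc_Suc: "N1 (Suc d) (Suc k) = N1 (Suc d) k + N1 d (Suc k) + N1 d k"
proof -
  let ?P = "{xs \<in> list_ball (Suc d) k. hd xs \<ge> 0}"
  let ?M = "{xs \<in> list_ball (Suc d) k. hd xs \<le> 0}"
  let ?p = "\<lambda>xs :: int list. (hd xs + 1) # tl xs"
  let ?m = "\<lambda>xs :: int list. (hd xs - 1) # tl xs"
  let ?Z = "Cons 0 ` list_ball d (Suc k)"
  have ne: "xs \<noteq> []" if "xs \<in> list_ball (Suc d) k" for xs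
    using that by (auto simp: list_ball_def)
  have eq: "list_ball (Suc d) (Suc k) = ?Z \<union> (?p ` ?P \<union> ?m ` ?M)" (is "_ = ?R")
  proof (intro equalityI subsetI)
    fix xs assume xs: "xs \<in> list_ball (Suc d) (Suc k)"
    then obtain y ys where ys: "xs = y # ys" by (auto simp: list_ball_def length_Suc_conv)
    consider "y = 0" | "y > 0" | "y < 0" by linarith
    then show "xs \<in> ?R"
    proof cases
      case 1
      with xs ys show ?thesis by (auto simp: list_ball_def)
    next
      case 2
      then have "(y - 1) # ys \<in> ?P" using xs ys by (auto simp: list_ball_def)
      then have "?p ((y - 1) # ys) \<in> ?p ` ?P" by (rule imageI)
      then show ?thesis using ys by simp
    next
      case 3
      then have "(y + 1) # ys \<in> ?M" using xs ys by (auto simp: list_ball_def)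
      then have "?m ((y + 1) # ys) \<in> ?m ` ?M" by (rule imageI)
      then show ?thesis using ys by simp
    qed
  next
    fix xs assume "xs \<in> ?R"
    then show "xs \<in> list_ball (Suc d) (Suc k)"
      by (auto simp: list_ball_def length_Suc_conv)
  qed
  have injp: "inj_on ?p ?P" and injm: "inj_on ?m ?M"
    by (auto intro!: inj_onI intro: list.expand dest: ne)
  have "card (list_ball (Suc d) (Suc k)) = card ?Z + card (?p ` ?P \<union> ?m ` ?M)"
    unfolding eq by (rule card_Un_disjoint) auto
  also have "card (?p ` ?P \<union> ?m ` ?M) = card (?p ` ?P) + card (?m ` ?M)"
    by (rule card_Un_disjoint) auto
  also have "card (?p ` ?P) + card (?m ` ?M) = card ?P + card ?M"
    using injp injm by (simp add: card_image)
  also have "card ?P + card ?M = card (?P \<union> ?M) + card (?P \<inter> ?M)"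
    by (rule card_Un_Int) auto
  also have "?P \<union> ?M = list_ball (Suc d) k" by auto
  also have "?P \<inter> ?M = Cons 0 ` list_ball d k"
    by (auto simp: list_ball_def length_Suc_conv image_iff)
  finally show ?thesis
    by (simp add: N1_eq_card_list_ball card_image)
qed

lemma N1_pos [simp]: "N1 d k > 0"
  by (induction d k rule: diff_induct) (auto simp: N1_Suc_Suc)

lemma N1_le_Suc: "N1 d k \<le> N1 d (Suc k)"
  by (cases d) (auto simp: N1_Suc_Suc)

lemma N1_mono: "j \<le> k \<Longrightarrow> N1 d j \<le> N1 d k"
  using N1_le_Suc by (rule lift_Suc_mono_le)

lemma N1_less_Suc: "d > 0 \<Longrightarrow> N1 d k < N1 d (Suc k)"
  by (cases d) (auto simp: N1_Suc_Suc)

lemma less_N1: "d > 0 \<Longrightarrow> k < N1 d k"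
proof (induction k)
  case (Suc k)
  then show ?case using N1_less_Suc[of d k] by linarith
qed simp

lemma log_concave_shift_mult:
  fixes a :: "nat \<Rightarrow> real"
  assumes pos: "\<And>k. a k > 0" and lc: "\<And>k. a k * a (k + 2) \<le> a (k + 1) ^ 2"
  shows "a k * a (k + 3) \<le> a (k + 1) * a (k + 2)"
proof -
  have "(a k * a (k + 2)) * (a (k + 1) * a (k + 3)) \<le> a (k + 1) ^ 2 * a (k + 2) ^ 2"
    using lc[of k] lc[of "k + 1"] pos
    by (intro mult_mono) (auto simp: less_imp_le algebra_simps eval_nat_numeral)
  then have "(a k * a (k + 3)) * (a (k + 1) * a (k + 2))
      \<le> (a (k + 1) * a (k + 2)) * (a (k + 1) * a (k + 2))"
    by (simp add: power2_eq_square mult_ac)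
  then show ?thesis
    using pos by (simp add: mult_le_cancel_right)
qed

lemma log_concave_sum:
  fixes a S :: "nat \<Rightarrow> real"
  assumes pos: "\<And>k. a k > 0" and lc: "\<And>k. a k * a (k + 2) \<le> a (k + 1) ^ 2"
    and S0: "S 0 = a 0" and S: "\<And>k. S (Suc k) = S k + a (Suc k)"
  shows "S k * S (k + 2) \<le> S (k + 1) ^ 2"
proof -
  have Q: "S k * a (k + 2) \<le> S (k + 1) * a (k + 1)" for k
  proof (induction k)
    case 0
    show ?case using lc[of 0] mult_pos_pos[OF pos[of 1] pos[of 0]]
      by (simp add: S0 S power2_eq_square distrib_right distrib_left numeral_2_eq_2 mult.commute)
  next
    case (Suc k)
    have S_pos: "S j > 0" for j
      by (induction j) (auto simp: S0 S pos add_pos_pos)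
    have "a (k + 1) * (S (k + 1) * a (k + 3)) \<le> S (k + 1) * a (k + 2) ^ 2"
      using mult_left_mono[OF lc[of "k + 1"] less_imp_le[OF S_pos[of "k + 1"]]]
      by (simp add: algebra_simps eval_nat_numeral)
    also have "\<dots> = (S k * a (k + 2)) * a (k + 2) + a (k + 1) * a (k + 2) ^ 2"
      by (simp add: S power2_eq_square algebra_simps)
    also have "\<dots> \<le> (S (k + 1) * a (k + 1)) * a (k + 2) + a (k + 1) * a (k + 2) ^ 2"
      using Suc pos[of "k + 2"] by (simp add: mult_right_mono)
    also have "\<dots> = a (k + 1) * (S (k + 2) * a (k + 2))"
      by (simp add: S power2_eq_square algebra_simps)
    finally show ?case using pos[of "k + 1"] by (simp add: eval_nat_numeral)
  qed
  from Q[of k] show ?thesis by (simp add: S power2_eq_square algebra_simps)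
qed

lemma log_concave_N1: "real (N1 d k) * real (N1 d (k + 2)) \<le> real (N1 d (k + 1)) ^ 2"
proof (induction d arbitrary: k)
  case (Suc d)
  define a where "a k = real (N1 d k)" for k
  define c where "c k = (case k of 0 \<Rightarrow> a 0 | Suc j \<Rightarrow> a (Suc j) + a j)" for k
  have a_pos: "a k > 0" for k by (simp add: a_def)
  have a_lc: "a k * a (k + 2) \<le> a (k + 1) ^ 2" for k
    using Suc by (simp add: a_def)
  have c_lc: "c k * c (k + 2) \<le> c (k + 1) ^ 2" for k
  proof (cases k)
    case 0
    then show ?thesis
      using a_lc[of 0] mult_pos_pos[OF a_pos[of 0] a_pos[of 0]]
        mult_pos_pos[OF a_pos[of 0] a_pos[of 1]] mult_pos_pos[OF a_pos[of 1] a_pos[of 1]]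
      by (simp add: c_def power2_eq_square algebra_simps numeral_2_eq_2)
  next
    case (Suc j)
    have "(q + p) * (s + r) \<le> (r + q) ^ 2"
      if "p * r \<le> q ^ 2" "q * s \<le> r ^ 2" "p * s \<le> q * r" for p q r s :: real
      using that by (simp add: power2_eq_square algebra_simps)
    from this[OF a_lc[of j] _ log_concave_shift_mult[OF a_pos a_lc, of j]] a_lc[of "j + 1"]
    show ?thesis by (simp add: c_def Suc eval_nat_numeral)
  qed
  have c_pos: "c k > 0" for k
    by (auto simp: c_def a_pos add_pos_pos split: nat.split)
  show ?case
    by (rule log_concave_sum[of c "\<lambda>k. real (N1 (Suc d) k)", OF c_pos c_lc])
      (simp_all add: c_def a_def N1_Suc_Suc)
qed simp

definition N1_drop :: "nat \<Rightarrow> nat \<Rightarrow> real" where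
  "N1_drop d k = 1 / real (N1 d k) - 1 / real (N1 d (Suc k))"

lemma N1_drop_pos: "d > 0 \<Longrightarrow> N1_drop d k > 0"
  using N1_less_Suc[of d k] frac_less2[of 1 1 "real (N1 d k)" "real (N1 d (Suc k))"]
  by (simp add: N1_drop_def)

lemma N1_drop_Suc_le: "N1_drop d (Suc k) \<le> N1_drop d k"
proof -
  define x y z where "x = real (N1 d k)" and "y = real (N1 d (Suc k))"
    and "z = real (N1 d (Suc (Suc k)))"
  have pos: "x > 0" "y > 0" "z > 0" by (simp_all add: x_def y_def z_def)
  have lc: "x * z \<le> y ^ 2" using log_concave_N1[of d k] by (simp add: x_def y_def z_def)
  have "(2 * (x * z)) ^ 2 \<le> (y * (x + z)) ^ 2"
  proof -
    have "(2 * (x * z)) ^ 2 = x * z * (4 * (x * z))" by (simp add: power2_eq_square)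
    also have "\<dots> \<le> y ^ 2 * (4 * (x * z))" using lc pos by (intro mult_right_mono) auto
    also have "\<dots> \<le> y ^ 2 * (x + z) ^ 2"
      using sum_squares_ge_zero[of "x - z" 0]
      by (intro mult_left_mono) (auto simp: power2_eq_square algebra_simps)
    finally show ?thesis by (simp add: power_mult_distrib)
  qed
  then have "2 * (x * z) \<le> y * (x + z)"
    by (rule power2_le_imp_le) (use pos in auto)
  then have "2 * (x * z) * y \<le> y * (x + z) * y"
    using pos by (intro mult_right_mono) auto
  then have "1 / y - 1 / z \<le> 1 / x - 1 / y"
    using pos by (simp add: field_simps)
  then show ?thesis by (simp add: N1_drop_def x_def y_def z_def)
qed

lemma N1_drop_antimono: "j \<le> k \<Longrightarrow> N1_drop d k \<le> N1_drop d j"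
  using N1_drop_Suc_le by (rule lift_Suc_antimono_le)

lemma N1_drop_1_less_0:
  assumes "d > 0"
  shows "N1_drop d 1 < N1_drop d 0"
proof -
  have "real (N1 d 1) \<ge> 2" using less_N1[OF assms, of 1] by simp
  then have "2 / real (N1 d 1) \<le> 1" by simp
  moreover have "1 / real (N1 d (Suc 1)) > 0" by simp
  moreover have "N1_drop d 0 - N1_drop d 1
      = 1 - 2 / real (N1 d 1) + 1 / real (N1 d (Suc 1))"
    by (simp add: N1_drop_def)
  ultimately show ?thesis by linarith
qed

lemma N1_sphere_bound:
  obtains c :: real where "c \<ge> 0"
    "\<And>k. real (Suc k) * (real (N1 d (Suc k)) - real (N1 d k)) \<le> c * real (N1 d (Suc k))"
    "\<And>k. real k * real (N1 d k) \<le> (1 + c) * real (N1 (Suc d) k)"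
proof -
  have step: "real k * real (N1 d k) \<le> (1 + c) * real (N1 (Suc d) k)"
    if "c \<ge> 0" and c: "\<And>k. real (Suc k) * (real (N1 d (Suc k)) - real (N1 d k)) \<le> c * real (N1 d (Suc k))"
    for c :: real and d k
  proof (induction k)
    case (Suc k)
    have "real (Suc k) * real (N1 d (Suc k))
        = real (Suc k) * (real (N1 d (Suc k)) - real (N1 d k)) + real k * real (N1 d k) + real (N1 d k)"
      by (simp add: algebra_simps)
    also have "\<dots> \<le> c * real (N1 d (Suc k)) + (1 + c) * real (N1 (Suc d) k) + real (N1 d k)"
      using c[of k] Suc by simp
    also have "\<dots> \<le> (1 + c) * real (N1 (Suc d) (Suc k))"
      using \<open>c \<ge> 0\<close> by (simp add: N1_Suc_Suc algebra_simps)
    finally show ?case .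
  qed (use that in simp)
  have "\<exists>c\<ge>0. \<forall>k. real (Suc k) * (real (N1 d (Suc k)) - real (N1 d k)) \<le> c * real (N1 d (Suc k))"
  proof (induction d)
    case 0
    show ?case by (intro exI[of _ 0]) simp
  next
    case (Suc d)
    then obtain c where c: "c \<ge> 0"
      "\<And>k. real (Suc k) * (real (N1 d (Suc k)) - real (N1 d k)) \<le> c * real (N1 d (Suc k))"
      by blast
    show ?case
    proof (intro exI[of _ "2 * (1 + c)"] conjI allI)
      fix k
      have "real (Suc k) * (real (N1 (Suc d) (Suc k)) - real (N1 (Suc d) k))
          = real (Suc k) * (real (N1 d (Suc k)) + real (N1 d k))"
        by (simp add: N1_Suc_Suc)
      also have "\<dots> \<le> real (Suc k) * (2 * real (N1 d (Suc k)))"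
        using N1_le_Suc[of d k] by (intro mult_left_mono) auto
      also have "\<dots> \<le> 2 * (1 + c) * real (N1 (Suc d) (Suc k))"
        using step[OF c, of "Suc k"] by (simp add: algebra_simps)
      finally show "real (Suc k) * (real (N1 (Suc d) (Suc k)) - real (N1 (Suc d) k))
        \<le> 2 * (1 + c) * real (N1 (Suc d) (Suc k))" .
    qed (use c in simp)
  qed
  then show ?thesis using step that by blast
qed

lemma C_term_nonneg: "C_term d k \<ge> 0"
  using N1_mono[of "k - 1" k "d - 1"] by (simp add: C_term_def)

lemma C_term_summable_on: "d > 0 \<Longrightarrow> C_term d summable_on {1..}"
proof -
  assume "d > 0"
  then obtain e where e: "d = Suc e" by (cases d) auto
  obtain c :: real where c: "c \<ge> 0"
    "\<And>k. real (Suc k) * (real (N1 e (Suc k)) - real (N1 e k)) \<le> c * real (N1 e (Suc k))"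
    "\<And>k. real k * real (N1 e k) \<le> (1 + c) * real (N1 (Suc e) k)"
    using N1_sphere_bound[of e] by blast
  have bound: "C_term d (Suc k) \<le> c * (1 + c) * (1 / real (Suc k) ^ 2)" for k
  proof -
    have "real (Suc k) * (real (Suc k) * (real (N1 e (Suc k)) - real (N1 e k)))
        \<le> real (Suc k) * (c * real (N1 e (Suc k)))"
      using c(2) by (intro mult_left_mono) auto
    also have "\<dots> = c * (real (Suc k) * real (N1 e (Suc k)))" by simp
    also have "\<dots> \<le> c * ((1 + c) * real (N1 d (Suc k)))"
      using c(1) c(3)[of "Suc k"] unfolding e by (intro mult_left_mono) auto
    finally show ?thesis
      by (simp add: C_term_def e field_simps power2_eq_square del: of_nat_Suc)
  qed
  have "summable (\<lambda>k. c * (1 + c) * (1 / real (Suc k) ^ 2))"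
    by (intro summable_mult) (use inverse_squares_sums in \<open>auto dest: sums_summable simp: add.commute\<close>)
  then have "summable (\<lambda>k. C_term d (Suc k))"
    by (rule summable_comparison_test') (use bound C_term_nonneg in auto)
  then have "(\<lambda>k. C_term d (Suc k)) summable_on UNIV"
    by (rule summable_nonneg_imp_summable_on) (rule C_term_nonneg)
  also have "?this \<longleftrightarrow> C_term d summable_on {1..}"
    by (rule summable_on_reindex_bij_witness[of _ "\<lambda>k. k - 1" Suc]) auto
  finally show ?thesis .
qed

section \<open>The variation of the maximal function of a unit mass\<close>

lemma inverse_N1_antimono: "j \<le> k \<Longrightarrow> 1 / real (N1 d k) \<le> 1 / real (N1 d j)"
  using N1_mono[of j k d] by (intro frac_le) auto

lemma inverse_N1_tendsto_0:
  assumes "d > 0"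
  shows "(\<lambda>k. 1 / real (N1 d k)) \<longlonglongrightarrow> 0"
proof (rule tendsto_sandwich[of "\<lambda>_. 0" _ _ "\<lambda>k. inverse (real (Suc k))"])
  show "eventually (\<lambda>k. 1 / real (N1 d k) \<le> inverse (real (Suc k))) sequentially"
    using less_N1[OF assms] by (intro always_eventually) (auto simp: inverse_eq_divide Suc_le_eq intro!: frac_le simp del: of_nat_Suc)
  show "(\<lambda>k. inverse (real (Suc k))) \<longlonglongrightarrow> 0"
    by (rule LIMSEQ_inverse_real_of_nat)
qed auto

lemma has_sum_variation_on_line:
  fixes G :: "nat \<Rightarrow> real"
  assumes anti: "\<And>j k. j \<le> k \<Longrightarrow> G k \<le> G j" and lim: "G \<longlonglongrightarrow> 0"
  shows "((\<lambda>t::int. \<bar>G (nat \<bar>t + 1\<bar> + k) - G (nat \<bar>t\<bar> + k)\<bar>) has_sum 2 * G k) UNIV"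
proof -
  let ?h = "\<lambda>j. \<bar>G (Suc j + k) - G (j + k)\<bar>"
  let ?f = "\<lambda>t::int. \<bar>G (nat \<bar>t + 1\<bar> + k) - G (nat \<bar>t\<bar> + k)\<bar>"
  have "(\<lambda>j. G (j + k)) \<longlonglongrightarrow> 0"
    using lim by (rule LIMSEQ_ignore_initial_segment)
  from telescope_sums'[OF this] have "(\<lambda>j. G (j + k) - G (Suc j + k)) sums G k"
    by simp
  moreover have "?h = (\<lambda>j. G (j + k) - G (Suc j + k))"
    using anti by (auto simp: fun_eq_iff abs_if le_Suc_eq not_less) (smt (verit) le_Suc_eq order_refl)
  ultimately have h: "(?h has_sum G k) UNIV"
    by (intro sums_nonneg_imp_has_sum) auto
  have pos: "(?f has_sum G k) {0..}"
    using h by (rule iffD1[OF has_sum_reindex_bij_witness, rotated -1, where ?h1 = ?f and ?i1 = nat and ?j1 = int])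
      (auto simp: nat_add_distrib add.commute)
  have neg: "(?f has_sum G k) {..<0}"
    using h by (rule iffD1[OF has_sum_reindex_bij_witness, rotated -1, where ?h1 = ?f and ?i1 = "\<lambda>t. nat (- 1 - t)" and ?j1 = "\<lambda>j. - 1 - int j"])
      (auto simp: abs_minus_commute nat_add_distrib add.commute)
  have "{0..} \<union> {..<0::int} = UNIV" by auto
  then show ?thesis
    using has_sum_Un_disjoint[OF pos neg] by (simp add: disjoint_iff)
qed

lemma sum_list_abs_nonneg: "(0::int) \<le> (\<Sum>x\<leftarrow>xs. \<bar>f x\<bar>)"
  by (rule sum_list_nonneg) auto

definition list_sphere :: "nat \<Rightarrow> nat \<Rightarrow> int list set" where
  "list_sphere d k = {xs. length xs = d \<and> (\<Sum>x\<leftarrow>xs. \<bar>x\<bar>) = int k}"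

lemma finite_list_sphere [simp]: "finite (list_sphere d k)"
  by (rule finite_subset[OF _ finite_list_ball[of d k]]) (auto simp: list_sphere_def list_ball_def)

lemma card_list_sphere_0: "card (list_sphere d 0) = 1"
proof -
  have "list_sphere d 0 = list_ball d 0"
    by (auto simp: list_sphere_def list_ball_def intro!: antisym sum_list_nonneg)
  then show ?thesis using N1_0_right[of d] by (simp add: N1_eq_card_list_ball)
qed

lemma card_list_sphere_Suc: "real (card (list_sphere d (Suc k))) = real (N1 d (Suc k)) - real (N1 d k)"
proof -
  have "list_sphere d (Suc k) = list_ball d (Suc k) - list_ball d k"
    by (auto simp: list_sphere_def list_ball_def)
  moreover have "list_ball d k \<subseteq> list_ball d (Suc k)" by (auto simp: list_ball_def)
  ultimately show ?thesis
    by (simp add: card_Diff_subset N1_eq_card_list_ball of_nat_diff card_mono)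
qed

lemma has_sum_inverse_N1_lists:
  assumes "d > 0"
  shows "((\<lambda>xs. 2 * (1 / real (N1 d (nat (\<Sum>x\<leftarrow>xs. \<bar>x\<bar>)))))
    has_sum 2 * (1 + (\<Sum>\<^sub>\<infinity>k\<in>{1..}. C_term d k))) {xs. length xs = d - 1}"
proof -
  define w where "w k = (if k = 0 then 1 else C_term d k)" for k
  let ?G = "\<lambda>k. 1 / real (N1 d k)"
  have w: "real (card (list_sphere (d - 1) k)) * ?G k = w k" for k
    by (cases k) (auto simp: w_def C_term_def card_list_sphere_0 card_list_sphere_Suc)
  have "(C_term d has_sum (\<Sum>\<^sub>\<infinity>k\<in>{1..}. C_term d k)) {1..}"
    using C_term_summable_on[OF assms] by (rule has_sum_infsum)
  then have "(w has_sum (\<Sum>\<^sub>\<infinity>k\<in>{1..}. C_term d k)) {1..}"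
    by (rule has_sum_cong[THEN iffD1, rotated]) (auto simp: w_def)
  then have "(w has_sum (1 + (\<Sum>\<^sub>\<infinity>k\<in>{1..}. C_term d k))) (insert 0 {1..})"
    using has_sum_insert[of "0::nat" "{1..}" w "\<Sum>\<^sub>\<infinity>k\<in>{1..}. C_term d k"] by (simp add: w_def)
  moreover have "insert 0 {1..} = (UNIV :: nat set)" by auto
  ultimately have "(w has_sum (1 + (\<Sum>\<^sub>\<infinity>k\<in>{1..}. C_term d k))) UNIV" by simp
  then have outer: "((\<lambda>k. 2 * w k) has_sum 2 * (1 + (\<Sum>\<^sub>\<infinity>k\<in>{1..}. C_term d k))) UNIV"
    by (rule has_sum_cmult_right)
  have inner: "((\<lambda>xs. (\<lambda>(k, xs). 2 * ?G k) (k, xs)) has_sum 2 * w k) (list_sphere (d - 1) k)" for k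
    using has_sum_finite[of "list_sphere (d - 1) k" "\<lambda>xs. 2 * ?G k"] w[of k, symmetric]
    by (simp add: mult_ac)
  have "((\<lambda>(k, xs). 2 * ?G k) has_sum 2 * (1 + (\<Sum>\<^sub>\<infinity>k\<in>{1..}. C_term d k)))
      (Sigma UNIV (list_sphere (d - 1)))"
  proof (rule has_sum_SigmaI[OF inner outer])
    show "(\<lambda>(k, xs). 2 * ?G k) summable_on Sigma UNIV (list_sphere (d - 1))"
      by (rule summable_on_SigmaI[OF inner has_sum_imp_summable[OF outer]]) auto
  qed
  then show ?thesis
    by (rule iffD1[OF has_sum_reindex_bij_witness, rotated -1,
          where ?j1 = snd and ?i1 = "\<lambda>xs. (nat (\<Sum>x\<leftarrow>xs. \<bar>x\<bar>), xs)"])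
      (auto simp: list_sphere_def intro: sum_list_abs_nonneg)
qed

definition l1n :: "int ^ 'd::finite \<Rightarrow> nat" where
  "l1n x = nat (l1_abs x)"

definition edge_drop :: "'d::finite \<Rightarrow> int ^ 'd \<Rightarrow> real" where
  "edge_drop i z = \<bar>1 / real (N1 CARD('d) (l1n (z + axis i 1))) - 1 / real (N1 CARD('d) (l1n z))\<bar>"

lemma edge_drop_nonneg [simp]: "edge_drop i z \<ge> 0"
  by (simp add: edge_drop_def)

text \<open>The edges in direction \<open>i\<close> are sorted by the line in direction \<open>i\<close> that contains them.\<close>

lemma has_sum_edge_drop:
  fixes i :: "'d::finite"
  shows "(edge_drop i has_sum 2 * (1 + (\<Sum>\<^sub>\<infinity>k\<in>{1..}. C_term CARD('d) k))) UNIV"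
proof -
  let ?d = "CARD('d)"
  let ?G = "\<lambda>k. 1 / real (N1 ?d k)"
  let ?nn = "\<lambda>xs :: int list. nat (\<Sum>x\<leftarrow>xs. \<bar>x\<bar>)"
  let ?F = "\<lambda>(xs, t). \<bar>?G (nat \<bar>t + 1\<bar> + ?nn xs) - ?G (nat \<bar>t\<bar> + ?nn xs)\<bar>"
  have inner: "((\<lambda>t. ?F (xs, t)) has_sum 2 * ?G (?nn xs)) UNIV" for xs
    using has_sum_variation_on_line[of ?G "?nn xs", OF inverse_N1_antimono inverse_N1_tendsto_0]
    by simp
  have outer: "((\<lambda>xs. 2 * ?G (?nn xs)) has_sum 2 * (1 + (\<Sum>\<^sub>\<infinity>k\<in>{1..}. C_term ?d k)))
      {xs. length xs = ?d - 1}"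
    by (rule has_sum_inverse_N1_lists) simp
  have sum: "(?F has_sum 2 * (1 + (\<Sum>\<^sub>\<infinity>k\<in>{1..}. C_term ?d k)))
      (Sigma {xs. length xs = ?d - 1} (\<lambda>_. UNIV))"
  proof (rule has_sum_SigmaI[OF inner outer])
    show "?F summable_on Sigma {xs. length xs = ?d - 1} (\<lambda>_. UNIV)"
      by (rule summable_on_SigmaI[OF inner has_sum_imp_summable[OF outer]]) auto
  qed
  obtain js :: "'d list" where js: "set js = UNIV - {i}" "distinct js"
    using finite_distinct_list[of "UNIV - {i}"] by auto
  have len: "length js = ?d - 1"
    using distinct_card[OF js(2)] js(1) by (simp add: card_Diff_singleton)
  define \<phi> where "\<phi> n = (map (($) n) js, n $ i)" for n :: "int ^ 'd"
  have "bij_betw \<phi> UNIV (Sigma {xs. length xs = ?d - 1} (\<lambda>_. UNIV))"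
    unfolding bij_betw_def
  proof
    show "inj \<phi>"
    proof (rule injI)
      fix m n assume "\<phi> m = \<phi> n"
      then have "m $ j = n $ j" for j
        by (cases "j = i") (use js in \<open>auto simp: \<phi>_def\<close>)
      then show "m = n" by (simp add: vec_eq_iff)
    qed
    show "range \<phi> = Sigma {xs. length xs = ?d - 1} (\<lambda>_. UNIV)"
    proof (intro equalityI subsetI)
      fix p assume "p \<in> Sigma {xs :: int list. length xs = ?d - 1} (\<lambda>_. UNIV :: int set)"
      then obtain xs t where p: "p = (xs, t)" "length xs = length js" by (auto simp: len)
      define v :: "int ^ 'd" where "v = (\<chi> j. if j = i then t else the (map_of (zip js xs) j))"
      have "js ! k \<noteq> i" if "k < length js" for k
        using nth_mem[OF that] js(1) by auto
      then have "map (($) v) js = xs"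
        using p js by (auto simp: v_def intro!: nth_equalityI simp: map_of_zip_nth)
      then show "p \<in> range \<phi>"
        by (intro image_eqI[of _ _ v]) (auto simp: \<phi>_def p v_def)
    qed (auto simp: \<phi>_def len)
  qed
  moreover have "edge_drop i n = ?F (\<phi> n)" for n
  proof -
    have *: "l1n m = nat \<bar>m $ i\<bar> + ?nn (map (($) m) js)" for m :: "int ^ 'd"
    proof -
      have "l1_abs m = \<bar>m $ i\<bar> + (\<Sum>j\<in>UNIV - {i}. \<bar>m $ j\<bar>)"
        unfolding l1_abs_def by (rule sum.remove) auto
      also have "(\<Sum>j\<in>UNIV - {i}. \<bar>m $ j\<bar>) = (\<Sum>x\<leftarrow>map (($) m) js. \<bar>x\<bar>)"
        using js by (simp add: sum_list_distinct_conv_sum_set o_def)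
      finally show ?thesis
        by (simp only: l1n_def nat_add_distrib[OF abs_ge_zero sum_list_abs_nonneg])
    qed
    have js_eq: "map (($) (n + axis i 1)) js = map (($) n) js"
      using js by (auto simp: axis_def)
    have "l1n (n + axis i 1) = nat \<bar>n $ i + 1\<bar> + ?nn (map (($) n) js)"
      unfolding *[of "n + axis i 1"] js_eq by (simp add: axis_def)
    then show ?thesis by (simp add: edge_drop_def *[of n] \<phi>_def)
  qed
  ultimately show ?thesis
    using sum by (simp add: has_sum_reindex_bij_betw[symmetric] cong: has_sum_cong)
qed

section \<open>The maximal operator along an edge\<close>

lemma l1n_minus_commute: "l1n (x - y) = l1n (y - x)"
  by (simp add: l1n_def l1_abs_def abs_minus_commute)

lemma l1_abs_nonneg [simp]: "l1_abs x \<ge> 0"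
  by (simp add: l1_abs_def sum_nonneg)

lemma l1n_triangle: "l1n (x + y) \<le> l1n x + l1n y"
proof -
  have "l1_abs (x + y) \<le> l1_abs x + l1_abs y"
    unfolding l1_abs_def sum.distrib[symmetric] by (intro sum_mono) (simp add: abs_triangle_ineq)
  then show ?thesis by (simp add: l1n_def nat_add_distrib[symmetric] nat_mono)
qed

lemma l1n_eq_0_iff [simp]: "l1n x = 0 \<longleftrightarrow> x = 0"
proof -
  have "l1n x = 0 \<longleftrightarrow> l1_abs x = 0"
    using l1_abs_nonneg[of x] unfolding l1n_def by linarith
  also have "\<dots> \<longleftrightarrow> x = 0"
    by (simp add: l1_abs_def sum_nonneg_eq_0_iff vec_eq_iff)
  finally show ?thesis .
qed

lemma l1n_0 [simp]: "l1n 0 = 0"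
  by simp

lemma l1n_axis [simp]: "l1n (axis i 1) = 1"
proof -
  have "l1_abs (axis i 1) = (\<Sum>j\<in>UNIV. if j = i then 1 else 0)"
    unfolding l1_abs_def by (intro sum.cong) (auto simp: axis_def)
  then show ?thesis by (simp add: l1n_def)
qed

lemma l1n_add_axis: "l1n (z + axis i 1) = Suc (l1n z) \<or> l1n z = Suc (l1n (z + axis i 1))"
proof -
  define R where "R = (\<Sum>j\<in>UNIV - {i}. \<bar>z $ j\<bar>)"
  have R: "R \<ge> 0" by (simp add: R_def sum_nonneg)
  have "l1_abs z = \<bar>z $ i\<bar> + R"
    unfolding l1_abs_def R_def by (rule sum.remove) auto
  moreover have "l1_abs (z + axis i 1) = \<bar>z $ i + 1\<bar> + R"
  proof -
    have "l1_abs (z + axis i 1) = \<bar>(z + axis i 1) $ i\<bar> + (\<Sum>j\<in>UNIV - {i}. \<bar>(z + axis i 1) $ j\<bar>)"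
      unfolding l1_abs_def by (rule sum.remove) auto
    also have "(\<Sum>j\<in>UNIV - {i}. \<bar>(z + axis i 1) $ j\<bar>) = R"
      unfolding R_def by (rule sum.cong) (auto simp: axis_def)
    finally show ?thesis by (simp add: axis_def)
  qed
  ultimately show ?thesis using R unfolding l1n_def by linarith
qed

text \<open>
  This is where the convexity of \<open>1 / N1 d\<close> enters: \<open>edge_drop\<close> is \<open>N1_drop\<close> at the endpoint closer to
  the origin, which dominates \<open>N1_drop\<close> at the other endpoint.
\<close>

lemma N1_drop_le_edge_drop:
  fixes z :: "int ^ 'd::finite"
  assumes "l1n z \<le> k \<or> l1n (z + axis i 1) \<le> k"
  shows "N1_drop CARD('d) k \<le> edge_drop i z"
  using l1n_add_axis[of z i]
proof
  assume "l1n (z + axis i 1) = Suc (l1n z)"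
  then show ?thesis
    using assms N1_drop_antimono[of "l1n z" k "CARD('d)"]
    by (auto simp: edge_drop_def N1_drop_def abs_if)
next
  assume "l1n z = Suc (l1n (z + axis i 1))"
  then show ?thesis
    using assms N1_drop_antimono[of "l1n (z + axis i 1)" k "CARD('d)"]
    by (auto simp: edge_drop_def N1_drop_def abs_if)
qed

lemma edge_drop_pos: "edge_drop i z > 0"
  using N1_drop_le_edge_drop[of z "l1n z" i] N1_drop_pos[of "CARD('a)" "l1n z"] by simp

definition l1_ball_at :: "int ^ 'd::finite \<Rightarrow> nat \<Rightarrow> (int ^ 'd) set" where
  "l1_ball_at u k = {m. l1n (m - u) \<le> k}"

definition ball_mass :: "(int ^ 'd::finite \<Rightarrow> real) \<Rightarrow> int ^ 'd \<Rightarrow> nat \<Rightarrow> real" where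
  "ball_mass f u k = (\<Sum>m\<in>l1_ball_at u k. \<bar>f m\<bar>)"

lemma l1_ball_of_nat: "l1_ball (real k) = {m. l1n m \<le> k}"
  using l1_abs_nonneg by (auto simp: l1_ball_def l1n_def nat_le_iff)

lemma finite_l1_ball_of_nat: "finite (l1_ball (real k) :: (int ^ 'd::finite) set)"
  by (rule card_ge_0_finite) (simp add: card_l1_ball)

lemma l1_ball_at_eq_image: "l1_ball_at u k = (+) u ` l1_ball (real k)"
proof (intro equalityI subsetI)
  fix m assume "m \<in> l1_ball_at u k"
  then show "m \<in> (+) u ` l1_ball (real k)"
    by (intro image_eqI[of _ _ "m - u"]) (auto simp: l1_ball_at_def l1_ball_of_nat)
qed (auto simp: l1_ball_at_def l1_ball_of_nat)

lemma finite_l1_ball_at [simp]: "finite (l1_ball_at u k)"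
  by (simp add: l1_ball_at_eq_image finite_l1_ball_of_nat)

lemma l1_ball_at_0 [simp]: "l1_ball_at u 0 = {u}"
  by (auto simp: l1_ball_at_def)

lemma M1_eq_SUP:
  fixes f :: "int ^ 'd::finite \<Rightarrow> real"
  shows "M1 f n = (SUP k. ball_mass f n k / real (N1 CARD('d) k))"
proof -
  let ?F = "\<lambda>r. (\<Sum>m\<in>l1_ball r. \<bar>f (n + m)\<bar>) / real (card (l1_ball r :: (int ^ 'd) set))"
  have floor: "l1_ball r = (l1_ball (real (nat \<lfloor>r\<rfloor>)) :: (int ^ 'd) set)" if "r \<ge> 0" for r
    using that by (auto simp: l1_ball_def le_floor_iff[symmetric])
  have "?F ` {0..} = range (\<lambda>k. ?F (real k))"
  proof (intro equalityI subsetI)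
    fix y assume "y \<in> ?F ` {0..}"
    then obtain r where "r \<ge> 0" "y = ?F r" by auto
    then show "y \<in> range (\<lambda>k. ?F (real k))"
      using floor[of r] by (intro image_eqI[of _ _ "nat \<lfloor>r\<rfloor>"]) auto
  qed auto
  moreover have "?F (real k) = ball_mass f n k / real (N1 CARD('d) k)" for k
    unfolding card_l1_ball ball_mass_def l1_ball_at_eq_image
    by (subst sum.reindex) (auto simp: inj_on_def)
  ultimately show ?thesis unfolding M1_def by simp
qed

lemma ball_mass_nonneg: "ball_mass f u k \<ge> 0"
  by (simp add: ball_mass_def sum_nonneg)

lemma ball_mass_le_norm: "in_l1 f \<Longrightarrow> ball_mass f u k \<le> l1_norm f"
  unfolding ball_mass_def l1_norm_def in_l1_def by (rule finite_sum_le_infsum) auto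

lemma bdd_above_averages:
  fixes f :: "int ^ 'd::finite \<Rightarrow> real"
  assumes "in_l1 f"
  shows "bdd_above (range (\<lambda>k. ball_mass f u k / real (N1 CARD('d) k)))"
proof (rule bdd_aboveI2)
  fix k
  have "ball_mass f u k / real (N1 CARD('d) k) \<le> ball_mass f u k / 1"
    using N1_pos[of "CARD('d)" k] by (intro divide_left_mono ball_mass_nonneg) (auto simp: Suc_le_eq)
  also have "\<dots> \<le> l1_norm f" using ball_mass_le_norm[OF assms] by simp
  finally show "ball_mass f u k / real (N1 CARD('d) k) \<le> l1_norm f" .
qed

lemma average_le_M1:
  fixes f :: "int ^ 'd::finite \<Rightarrow> real"
  assumes "in_l1 f"
  shows "ball_mass f u k / real (N1 CARD('d) k) \<le> M1 f u"
  unfolding M1_eq_SUP by (rule cSUP_upper[OF UNIV_I bdd_above_averages[OF assms]])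

text \<open>Compare the ball of radius \<open>k\<close> at \<open>u\<close> with the ball of radius \<open>k + 1\<close> at \<open>v\<close> that contains it.\<close>

lemma M1_le_M1_neighbour:
  fixes f :: "int ^ 'd::finite \<Rightarrow> real"
  assumes f: "in_l1 f" and uv: "l1n (u - v) \<le> 1"
    and T: "\<And>k. N1_drop CARD('d) k * ball_mass f u k \<le> T"
  shows "M1 f u \<le> M1 f v + T"
  unfolding M1_eq_SUP[of f u]
proof (rule cSUP_least)
  fix k
  have "l1_ball_at u k \<subseteq> l1_ball_at v (Suc k)"
  proof
    fix m assume "m \<in> l1_ball_at u k"
    then show "m \<in> l1_ball_at v (Suc k)"
      using uv l1n_triangle[of "m - u" "u - v"] by (auto simp: l1_ball_at_def)
  qed
  then have mass: "ball_mass f u k \<le> ball_mass f v (Suc k)"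
    unfolding ball_mass_def by (intro sum_mono2) auto
  have "ball_mass f u k / real (N1 CARD('d) k)
      = N1_drop CARD('d) k * ball_mass f u k + ball_mass f u k / real (N1 CARD('d) (Suc k))"
    by (simp add: N1_drop_def algebra_simps)
  also have "\<dots> \<le> T + ball_mass f v (Suc k) / real (N1 CARD('d) (Suc k))"
    using T[of k] mass by (intro add_mono divide_right_mono) auto
  also have "\<dots> \<le> T + M1 f v"
    using average_le_M1[OF f, of v "Suc k"] by simp
  finally show "ball_mass f u k / real (N1 CARD('d) k) \<le> M1 f v + T" by simp
qed simp

definition edge_conv :: "(int ^ 'd::finite \<Rightarrow> real) \<Rightarrow> 'd \<Rightarrow> int ^ 'd \<Rightarrow> real" where
  "edge_conv f i n = (\<Sum>\<^sub>\<infinity>m. \<bar>f m\<bar> * edge_drop i (n - m))"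

lemma edge_conv_has_sum:
  fixes f :: "int ^ 'd::finite \<Rightarrow> real"
  assumes "in_l1 f"
  defines "S \<equiv> 2 * (1 + (\<Sum>\<^sub>\<infinity>k\<in>{1..}. C_term CARD('d) k))"
  shows "(\<lambda>m. \<bar>f m\<bar> * edge_drop i (n - m)) summable_on UNIV"
    and "(edge_conv f i has_sum l1_norm f * S) UNIV"
proof -
  let ?F = "\<lambda>(m, n). \<bar>f m\<bar> * edge_drop i (n - m)"
  have inner: "((\<lambda>n. ?F (m, n)) has_sum \<bar>f m\<bar> * S) UNIV" for m
  proof -
    have "((\<lambda>n. edge_drop i (n - m)) has_sum S) UNIV"
      using has_sum_edge_drop[of i] unfolding S_def
      by (rule iffD1[OF has_sum_reindex_bij_witness, rotated -1,
            where ?j1 = "\<lambda>z. z + m" and ?i1 = "\<lambda>n. n - m"]) auto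
    then show ?thesis by (simp add: has_sum_cmult_right)
  qed
  have outer: "((\<lambda>m. \<bar>f m\<bar> * S) has_sum l1_norm f * S) UNIV"
    using assms(1) unfolding in_l1_def l1_norm_def
    by (intro has_sum_cmult_left has_sum_infsum)
  have "?F summable_on UNIV \<times> UNIV"
    by (rule summable_on_SigmaI[OF inner has_sum_imp_summable[OF outer]]) auto
  then have "(?F has_sum l1_norm f * S) (UNIV \<times> UNIV)"
    by (rule has_sum_SigmaI[OF inner outer])
  then have sum: "((\<lambda>(n, m). \<bar>f m\<bar> * edge_drop i (n - m)) has_sum l1_norm f * S) (UNIV \<times> UNIV)"
    by (subst (asm) has_sum_swap) simp
  show summable: "(\<lambda>m. \<bar>f m\<bar> * edge_drop i (n - m)) summable_on UNIV" for n
    using summable_on_SigmaD1[OF has_sum_imp_summable[OF sum], of n] by simp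
  show "(edge_conv f i has_sum l1_norm f * S) UNIV"
    using has_sum_SigmaD[OF sum, of "edge_conv f i"] has_sum_infsum[OF summable]
    by (simp add: edge_conv_def)
qed

lemma sum_le_edge_conv:
  assumes "in_l1 f" "finite A"
  shows "(\<Sum>m\<in>A. \<bar>f m\<bar> * edge_drop i (n - m)) \<le> edge_conv f i n"
  unfolding edge_conv_def
  using assms by (intro finite_sum_le_infsum edge_conv_has_sum) auto

lemma N1_drop_le_edge_drop_ball:
  fixes m :: "int ^ 'd::finite"
  assumes "u = n \<or> u = n + axis i 1" "m \<in> l1_ball_at u k"
  shows "N1_drop CARD('d) k \<le> edge_drop i (n - m)"
proof (rule N1_drop_le_edge_drop)
  show "l1n (n - m) \<le> k \<or> l1n (n - m + axis i 1) \<le> k"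
    using assms l1n_minus_commute[of m u] by (auto simp: l1_ball_at_def algebra_simps)
qed

lemma N1_drop_ball_mass_le:
  fixes f :: "int ^ 'd::finite \<Rightarrow> real"
  assumes "u = n \<or> u = n + axis i 1"
  shows "N1_drop CARD('d) k * ball_mass f u k \<le> (\<Sum>m\<in>l1_ball_at u k. \<bar>f m\<bar> * edge_drop i (n - m))"
  unfolding ball_mass_def sum_distrib_left
  by (intro sum_mono)
    (use N1_drop_le_edge_drop_ball[OF assms] in \<open>auto simp: mult.commute intro!: mult_left_mono\<close>)

lemma M1_edge_le:
  fixes f :: "int ^ 'd::finite \<Rightarrow> real"
  assumes f: "in_l1 f"
    and T: "\<And>u k. u = n \<or> u = n + axis i 1 \<Longrightarrow> N1_drop CARD('d) k * ball_mass f u k \<le> T"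
  shows "\<bar>M1 f (n + axis i 1) - M1 f n\<bar> \<le> T"
proof -
  have "M1 f n \<le> M1 f (n + axis i 1) + T"
    using T l1n_minus_commute[of n "n + axis i 1"] by (intro M1_le_M1_neighbour f) auto
  moreover have "M1 f (n + axis i 1) \<le> M1 f n + T"
    using T by (intro M1_le_M1_neighbour f) auto
  ultimately show ?thesis by (simp add: abs_le_iff)
qed

lemma M1_edge_le_conv:
  fixes f :: "int ^ 'd::finite \<Rightarrow> real"
  assumes "in_l1 f"
  shows "\<bar>M1 f (n + axis i 1) - M1 f n\<bar> \<le> edge_conv f i n"
proof (rule M1_edge_le[OF assms])
  fix u k assume "u = n \<or> u = n + axis i 1"
  then show "N1_drop CARD('d) k * ball_mass f u k \<le> edge_conv f i n"
    by (rule order_trans[OF N1_drop_ball_mass_le sum_le_edge_conv[OF assms finite_l1_ball_at]])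
qed

text \<open>
  Radius \<open>0\<close> loses the mass at \<open>m1\<close>, and any larger radius loses \<open>N1_drop d 0 - N1_drop d 1\<close> of the
  mass at \<open>m0\<close>; so the loss is bounded below uniformly in the radius.
\<close>

lemma M1_edge_less_conv:
  fixes f :: "int ^ 'd::finite \<Rightarrow> real"
  assumes f: "in_l1 f" and m0: "m0 = n \<or> m0 = n + axis i 1" "f m0 \<noteq> 0"
    and m1: "m1 \<noteq> n" "m1 \<noteq> n + axis i 1" "f m1 \<noteq> 0"
  shows "\<bar>M1 f (n + axis i 1) - M1 f n\<bar> < edge_conv f i n"
proof -
  let ?d = "CARD('d)" and ?e = "\<lambda>m. edge_drop i (n - m)"
  define \<epsilon> where "\<epsilon> = min (\<bar>f m1\<bar> * ?e m1) (\<bar>f m0\<bar> * (N1_drop ?d 0 - N1_drop ?d 1))"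
  have "\<epsilon> > 0"
    using m0(2) m1(3) edge_drop_pos[of i "n - m1"] N1_drop_1_less_0[of ?d] by (simp add: \<epsilon>_def)
  have "N1_drop ?d k * ball_mass f u k \<le> edge_conv f i n - \<epsilon>"
    if u: "u = n \<or> u = n + axis i 1" for u k
  proof (cases k)
    case 0
    have "N1_drop ?d 0 * ball_mass f u 0 + \<bar>f m1\<bar> * ?e m1 \<le> (\<Sum>m\<in>{u}. \<bar>f m\<bar> * ?e m) + \<bar>f m1\<bar> * ?e m1"
      using N1_drop_ball_mass_le[OF u, of 0 f] by simp
    also have "\<dots> = (\<Sum>m\<in>{u, m1}. \<bar>f m\<bar> * ?e m)"
      using u m1 by auto
    also have "\<dots> \<le> edge_conv f i n"
      by (rule sum_le_edge_conv[OF f]) simp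
    finally show ?thesis unfolding 0 \<epsilon>_def by linarith
  next
    case (Suc j)
    have m0k: "m0 \<in> l1_ball_at u k"
      using u m0(1) l1n_minus_commute[of n "n + axis i 1"] by (auto simp: l1_ball_at_def Suc)
    have "N1_drop ?d 0 \<le> ?e m0"
      by (rule N1_drop_le_edge_drop_ball[OF m0(1)]) simp
    moreover have "N1_drop ?d k \<le> N1_drop ?d 1"
      by (rule N1_drop_antimono) (simp add: Suc)
    ultimately have "\<epsilon> \<le> \<bar>f m0\<bar> * (?e m0 - N1_drop ?d k)"
      unfolding \<epsilon>_def by (intro min.coboundedI2 mult_left_mono) auto
    also have "\<dots> \<le> (\<Sum>m\<in>l1_ball_at u k. \<bar>f m\<bar> * (?e m - N1_drop ?d k))"
      using m0k by (rule member_le_sum) (use N1_drop_le_edge_drop_ball[OF u] in auto)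
    also have "\<dots> = (\<Sum>m\<in>l1_ball_at u k. \<bar>f m\<bar> * ?e m) - N1_drop ?d k * ball_mass f u k"
      by (simp add: ball_mass_def sum_distrib_left sum_subtractf algebra_simps)
    also have "\<dots> \<le> edge_conv f i n - N1_drop ?d k * ball_mass f u k"
      using sum_le_edge_conv[OF f finite_l1_ball_at] by simp
    finally show ?thesis by simp
  qed
  then have "\<bar>M1 f (n + axis i 1) - M1 f n\<bar> \<le> edge_conv f i n - \<epsilon>"
    by (rule M1_edge_le[OF f])
  with \<open>\<epsilon> > 0\<close> show ?thesis by linarith
qed

lemma infsum_ennreal:
  assumes "f summable_on A" "\<And>x. x \<in> A \<Longrightarrow> f x \<ge> 0"
  shows "(\<Sum>\<^sub>\<infinity>x\<in>A. ennreal (f x)) = ennreal (\<Sum>\<^sub>\<infinity>x\<in>A. f x)"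
proof -
  have "sum (ennreal \<circ> f) F = ennreal (sum f F)" if "finite F" "F \<subseteq> A" for F
    using that assms(2) by (simp add: sum_ennreal subset_iff)
  then have "infsum (ennreal \<circ> f) A = ennreal (infsum f A)"
    using assms(1) by (intro infsum_comm_additive_general) auto
  then show ?thesis by (simp add: o_def)
qed

lemma Var_eq_ennreal:
  fixes f :: "int ^ 'd::finite \<Rightarrow> real"
  assumes "\<And>i. (\<lambda>n. \<bar>f (n + axis i 1) - f n\<bar>) summable_on UNIV"
  shows "Var f = ennreal (\<Sum>i\<in>UNIV. \<Sum>\<^sub>\<infinity>n. \<bar>f (n + axis i 1) - f n\<bar>)"
  unfolding Var_def using assms by (simp add: infsum_ennreal sum_ennreal infsum_nonneg)

lemma is_delta_imp_in_l1_and_norm: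
  assumes "\<And>n. n \<noteq> p \<Longrightarrow> f n = 0"
  shows "in_l1 f" "l1_norm f = \<bar>f p\<bar>"
proof -
  have "((\<lambda>n. \<bar>f n\<bar>) has_sum \<bar>f p\<bar>) {p}"
    using has_sum_finite[of "{p}" "\<lambda>n. \<bar>f n\<bar>"] by simp
  then have "((\<lambda>n. \<bar>f n\<bar>) has_sum \<bar>f p\<bar>) UNIV"
    by (rule has_sum_cong_neutral[THEN iffD1, rotated -1]) (use assms in auto)
  then show "in_l1 f" "l1_norm f = \<bar>f p\<bar>"
    by (auto simp: in_l1_def l1_norm_def has_sum_imp_summable infsumI)
qed

lemma M1_delta:
  fixes f :: "int ^ 'd::finite \<Rightarrow> real"
  assumes f: "\<And>n. n \<noteq> p \<Longrightarrow> f n = 0"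
  shows "M1 f n = \<bar>f p\<bar> / real (N1 CARD('d) (l1n (n - p)))"
proof -
  have l1: "in_l1 f"
    by (rule is_delta_imp_in_l1_and_norm(1)) (rule f)
  have mass: "ball_mass f n k = (if l1n (n - p) \<le> k then \<bar>f p\<bar> else 0)" for k
  proof -
    have "ball_mass f n k = (\<Sum>m\<in>l1_ball_at n k. if m = p then \<bar>f p\<bar> else 0)"
      unfolding ball_mass_def by (rule sum.cong) (use f in auto)
    also have "\<dots> = (if p \<in> l1_ball_at n k then \<bar>f p\<bar> else 0)" by simp
    finally show ?thesis using l1n_minus_commute[of n p] by (simp add: l1_ball_at_def)
  qed
  show ?thesis
  proof (rule antisym)
    show "M1 f n \<le> \<bar>f p\<bar> / real (N1 CARD('d) (l1n (n - p)))"
      unfolding M1_eq_SUP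
    proof (rule cSUP_least)
      fix k
      show "ball_mass f n k / real (N1 CARD('d) k) \<le> \<bar>f p\<bar> / real (N1 CARD('d) (l1n (n - p)))"
        using N1_mono[of "l1n (n - p)" k "CARD('d)"] by (auto simp: mass intro!: divide_left_mono)
    qed simp
    show "\<bar>f p\<bar> / real (N1 CARD('d) (l1n (n - p))) \<le> M1 f n"
      using average_le_M1[OF l1, of n "l1n (n - p)"] by (simp add: mass)
  qed
qed

lemma Var_M1_delta:
  fixes f :: "int ^ 'd::finite \<Rightarrow> real"
  assumes f: "\<And>n. n \<noteq> p \<Longrightarrow> f n = 0"
  shows "Var (M1 f) = ennreal (C_const CARD('d) * l1_norm f)"
proof -
  let ?S = "2 * (1 + (\<Sum>\<^sub>\<infinity>k\<in>{1..}. C_term CARD('d) k))"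
  have l1: "in_l1 f" "l1_norm f = \<bar>f p\<bar>"
    using is_delta_imp_in_l1_and_norm[of p f] f by auto
  have M1: "M1 f n = \<bar>f p\<bar> / real (N1 CARD('d) (l1n (n - p)))" for n
    by (rule M1_delta) (rule f)
  have "\<bar>M1 f (n + axis i 1) - M1 f n\<bar> = edge_conv f i n" for i n
  proof -
    have "edge_conv f i n = (\<Sum>\<^sub>\<infinity>m\<in>{p}. \<bar>f m\<bar> * edge_drop i (n - m))"
      unfolding edge_conv_def by (rule infsum_cong_neutral) (use f in auto)
    then have "edge_conv f i n = \<bar>f p\<bar> * edge_drop i (n - p)" by simp
    moreover have "M1 f (n + axis i 1) - M1 f n = \<bar>f p\<bar> *
        (1 / real (N1 CARD('d) (l1n (n - p + axis i 1))) - 1 / real (N1 CARD('d) (l1n (n - p))))"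
      by (simp add: M1 right_diff_distrib diff_add_eq)
    ultimately show ?thesis by (simp add: edge_drop_def abs_mult)
  qed
  then have sum: "((\<lambda>n. \<bar>M1 f (n + axis i 1) - M1 f n\<bar>) has_sum l1_norm f * ?S) UNIV" for i
    using edge_conv_has_sum(2)[OF l1(1), of i] by simp
  show ?thesis
    unfolding Var_eq_ennreal[OF has_sum_imp_summable[OF sum]] infsumI[OF sum]
    by (simp add: C_const_def mult_ac)
qed

lemma Var_M1_le_and_less:
  fixes f :: "int ^ 'd::finite \<Rightarrow> real"
  assumes f: "in_l1 f"
  shows "Var (M1 f) \<le> ennreal (C_const CARD('d) * l1_norm f)"
    and "\<not> is_delta f \<Longrightarrow> Var (M1 f) < ennreal (C_const CARD('d) * l1_norm f)"
proof -
  let ?S = "2 * (1 + (\<Sum>\<^sub>\<infinity>k\<in>{1..}. C_term CARD('d) k))"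
  let ?D = "\<lambda>i n. \<bar>M1 f (n + axis i 1) - M1 f n\<bar>"
  note conv = edge_conv_has_sum(2)[OF f]
  have D_summable: "?D i summable_on UNIV" for i
    using has_sum_imp_summable[OF conv[of i]]
    by (rule summable_on_comparison_test) (use M1_edge_le_conv[OF f] in auto)
  have le: "infsum (?D i) UNIV \<le> l1_norm f * ?S" for i
    using has_sum_infsum[OF D_summable] conv M1_edge_le_conv[OF f] by (rule has_sum_mono)
  have C: "C_const CARD('d) * l1_norm f = (\<Sum>i\<in>(UNIV :: 'd set). l1_norm f * ?S)"
    by (simp add: C_const_def)
  have Var: "Var (M1 f) = ennreal (\<Sum>i\<in>UNIV. infsum (?D i) UNIV)"
    by (rule Var_eq_ennreal[OF D_summable])
  show "Var (M1 f) \<le> ennreal (C_const CARD('d) * l1_norm f)"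
    unfolding Var C by (intro ennreal_leI sum_mono le)
  assume "\<not> is_delta f"
  then obtain m0 m1 where m: "f m0 \<noteq> 0" "f m1 \<noteq> 0" "m1 \<noteq> m0"
    unfolding is_delta_def by metis
  obtain i :: 'd where True by simp
  obtain n where n: "m0 = n \<or> m0 = n + axis i 1" "m1 \<noteq> n" "m1 \<noteq> n + axis i 1"
  proof (cases "m1 = m0 + axis i 1")
    case True
    have "m0 + axis i 1 \<noteq> m0 - axis i 1"
      by (auto simp: vec_eq_iff axis_def)
    with True show ?thesis by (intro that[of "m0 - axis i 1"]) (auto simp: m)
  next
    case False
    then show ?thesis using m by (intro that[of m0]) auto
  qed
  have "infsum (?D i) UNIV < l1_norm f * ?S"
    using has_sum_infsum[OF D_summable] conv M1_edge_le_conv[OF f] UNIV_I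
      M1_edge_less_conv[OF f n(1) m(1) n(2,3) m(2)]
    by (rule has_sum_strict_mono)
  then have "(\<Sum>i\<in>UNIV. infsum (?D i) UNIV) < (\<Sum>i\<in>(UNIV :: 'd set). l1_norm f * ?S)"
    using le by (intro sum_strict_mono_ex1 ballI bexI[of _ i]) (assumption | rule finite UNIV_I)+
  then show "Var (M1 f) < ennreal (C_const CARD('d) * l1_norm f)"
    unfolding Var C
    by (rule ennreal_less_iff[THEN iffD2, rotated]) (intro sum_nonneg infsum_nonneg abs_ge_zero)
qed

theorem theorem2:
  assumes "CARD('d::finite) \<ge> 2"
  shows "C_term CARD('d) summable_on {1..}
    \<and> (\<forall>f :: int ^ 'd \<Rightarrow> real. in_l1 f \<longrightarrow>
          Var (M1 f) \<le> ennreal (C_const CARD('d) * l1_norm f))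
    \<and> (\<forall>C :: real.
          (\<forall>f :: int ^ 'd \<Rightarrow> real. in_l1 f \<longrightarrow> Var (M1 f) \<le> ennreal (C * l1_norm f)) \<longrightarrow>
          C_const CARD('d) \<le> C)
    \<and> (\<forall>f :: int ^ 'd \<Rightarrow> real. in_l1 f \<longrightarrow>
          (Var (M1 f) = ennreal (C_const CARD('d) * l1_norm f) \<longleftrightarrow> is_delta f))"
proof (intro conjI allI impI)
  show "C_term CARD('d) summable_on {1..}" by (rule C_term_summable_on) simp
next
  fix f :: "int ^ 'd \<Rightarrow> real"
  assume "in_l1 f"
  then show "Var (M1 f) \<le> ennreal (C_const CARD('d) * l1_norm f)"
    by (rule Var_M1_le_and_less(1))
next
  fix C :: real
  assume C: "\<forall>f :: int ^ 'd \<Rightarrow> real. in_l1 f \<longrightarrow> Var (M1 f) \<le> ennreal (C * l1_norm f)"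
  define \<delta> :: "int ^ 'd \<Rightarrow> real" where "\<delta> n = (if n = 0 then 1 else 0)" for n
  have \<delta>: "\<And>n. n \<noteq> 0 \<Longrightarrow> \<delta> n = 0" by (simp add: \<delta>_def)
  have l1: "in_l1 \<delta>" "l1_norm \<delta> = 1"
    using is_delta_imp_in_l1_and_norm[of 0 \<delta>, OF \<delta>] by (simp_all add: \<delta>_def)
  have var: "Var (M1 \<delta>) = ennreal (C_const CARD('d) * l1_norm \<delta>)"
    by (rule Var_M1_delta) (rule \<delta>)
  have "Var (M1 \<delta>) \<le> ennreal (C * l1_norm \<delta>)"
    using C l1(1) by blast
  then have "ennreal (C_const CARD('d)) \<le> ennreal C"
    by (simp add: var l1(2))
  moreover have "C_const CARD('d) > 0"
    unfolding C_const_def by (intro mult_pos_pos add_pos_nonneg infsum_nonneg C_term_nonneg) auto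
  ultimately show "C_const CARD('d) \<le> C"
    by (auto simp: ennreal_le_iff2)
next
  fix f :: "int ^ 'd \<Rightarrow> real"
  assume "in_l1 f"
  show "Var (M1 f) = ennreal (C_const CARD('d) * l1_norm f) \<longleftrightarrow> is_delta f"
  proof
    assume "Var (M1 f) = ennreal (C_const CARD('d) * l1_norm f)"
    then show "is_delta f" using Var_M1_le_and_less(2)[OF \<open>in_l1 f\<close>] by auto
  next
    assume "is_delta f"
    then show "Var (M1 f) = ennreal (C_const CARD('d) * l1_norm f)"
      using Var_M1_delta[of _ f] by (auto simp: is_delta_def)
  qed
qed

end
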